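(* No infinite ring without zero divisors is a Ramsey algebra; that is, if $(A,+,\cdot)$ is an infinite ring without zero divisors, then the algebra $(A,\{+,\cdot\})$ is not a Ramsey algebra. In particular, no infinite integral domain is a Ramsey algebra.
   Context: Rings are associative but are not assumed to be commutative or to have a multiplicative identity. A ring $(A,+,\cdot)$ is regarded as the algebra $(A,\{+,\cdot\})$ whose operations are the two binary operations $+$ and $\cdot$. $\omega=\{0,1,2,\dotsc\}$ and $\mathbb{N}$ is the set of positive integers. An algebra is a pair $(A,\mathcal{F})$ where $A$ is a nonempty set and $\mathcal{F}$ is a (possibly empty) collection of finitary operations on $A$, none of which is nullary. For a finite sequence $\vec{x}$ whose length is the arity of $f$, $f(\vec{x})$ denotes $f$ applied to the terms of $\vec{x}$ in order; whenever $f(\vec{x})$ is written, the length of $\vec{x}$ is assumed to equal the arity of $f$. The symbol $\ast$ denotes concatenation of sequences. Orderly terms: an operation $f\colon A^m\to A$ is an orderly composition of a collection $\mathcal{C}$ of operations on $A$ if there are $n,k_1,\dotsc,k_n\in\mathbb{N}$ and $g,h_1,\dotsc,h_n\in\mathcal{C}$ such that $g$ is $n$-ary, $h_i$ is $k_i$-ary, $m=\sum_{i=1}^n k_i$, and $f(\vec{x}_1\ast\dotsb\ast\vec{x}_n)=g(h_1(\vec{x}_1),\dotsc,h_n(\vec{x}_n))$ for all finite sequences $\vec{x}_i$ in $A$ of length $k_i$. The collection of orderly terms over $\mathcal{F}$ is the smallest collection of operations on $A$ that includes $\mathcal{F}$, contains the identity function on $A$, and is closed under orderly composition. Reductions: for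 infinite sequences $\vec{a},\vec{b}\in{}^{\omega}A$ (sequences indexed by $\omega$), $\vec{b}\leq_{\mathcal{F}}\vec{a}$ ($\vec{b}$ is a reduction of $\vec{a}$) means that there are finite sequences $\vec{a}_k$ and orderly terms $f_k$ over $\mathcal{F}$ ($k\in\omega$) such that $\vec{a}_0\ast\vec{a}_1\ast\vec{a}_2\ast\dotsb$ is a subsequence of $\vec{a}$ and $\vec{b}(k)=f_k(\vec{a}_k)$ for all $k\in\omega$. $\mathrm{FR}_{\mathcal{F}}(\vec{b})$ is the set of all elements $f(\vec{b}_0)$ with $f$ an orderly term over $\mathcal{F}$ and $\vec{b}_0$ a finite subsequence of $\vec{b}$. $(A,\mathcal{F})$ is a Ramsey algebra if for every $\vec{a}\in{}^{\omega}A$ and $X\subseteq A$ there exists $\vec{b}\leq_{\mathcal{F}}\vec{a}$ such that $\mathrm{FR}_{\mathcal{F}}(\vec{b})$ is either contained in or disjoint from $X$. *)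

theory Defs
  imports "HOL-Library.FuncSet" "HOL-Library.NList"
begin

text \<open>
  An $n$-ary operation on $A$ is a pair $(n, f)$ where $f$ is a function from the lists of length $n$
  over $A$ to $A$. The function is taken to be extensional (it has the value \<^term>\<open>undefined\<close>
  outside its domain), so that equality of pairs is equality of operations.
\<close>

type_synonym 'a operation = "nat \<times> ('a list \<Rightarrow> 'a)"

definition operations :: "'a set \<Rightarrow> 'a operation set" where
  "operations A = {(n, f). n \<ge> 1 \<and> f \<in> nlists n A \<rightarrow>\<^sub>E A}"

definition identity_operation :: "'a set \<Rightarrow> 'a operation" where
  "identity_operation A = (1, \<lambda>xs\<in>nlists 1 A. hd xs)"

definition binary_operation :: "'a set \<Rightarrow> ('a \<Rightarrow> 'a \<Rightarrow> 'a) \<Rightarrow> 'a operation" where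
  "binary_operation A f = (2, \<lambda>xs\<in>nlists 2 A. f (xs ! 0) (xs ! 1))"

definition finitary_algebra :: "'a set \<Rightarrow> 'a operation set \<Rightarrow> bool" where
  "finitary_algebra A F \<longleftrightarrow> A \<noteq> {} \<and> F \<subseteq> operations A"

text \<open>
  In the next definition \<open>hs\<close> lists the inner operations $h_1, \dots, h_n$ and \<open>xss\<close> the argument
  tuples $\vec x_1, \dots, \vec x_n$.
\<close>

definition is_orderly_composite ::
    "'a set \<Rightarrow> 'a operation \<Rightarrow> 'a operation list \<Rightarrow> 'a operation \<Rightarrow> bool" where
  "is_orderly_composite A g hs f \<longleftrightarrow>
     length hs = fst g \<and>
     fst f = sum_list (map fst hs) \<and>
     (\<forall>xss. list_all2 (\<lambda>h xs. xs \<in> nlists (fst h) A) hs xss \<longrightarrow>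
        snd f (concat xss) = snd g (map2 (\<lambda>h xs. snd h xs) hs xss))"

inductive_set orderly_terms :: "'a set \<Rightarrow> 'a operation set \<Rightarrow> 'a operation set"
  for A :: "'a set" and F :: "'a operation set" where
    basic: "f \<in> F \<Longrightarrow> f \<in> orderly_terms A F"
  | identity: "identity_operation A \<in> orderly_terms A F"
  | composite: "\<lbrakk>g \<in> orderly_terms A F; \<forall>h\<in>set hs. h \<in> orderly_terms A F;
       f \<in> operations A; is_orderly_composite A g hs f\<rbrakk> \<Longrightarrow> f \<in> orderly_terms A F"

text \<open>
  The infinite concatenation $\vec a_0 \ast \vec a_1 \ast \vec a_2 \ast \cdots$. It is used only when
  every $\vec a_k$ is nonempty; then the first $n + 1$ of them have at least $n + 1$ terms in total.
\<close>

definition concat_seq :: "(nat \<Rightarrow> 'a list) \<Rightarrow> nat \<Rightarrow> 'a" where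
  "concat_seq as n = concat (map as [0..<Suc n]) ! n"

definition is_reduction ::
    "'a set \<Rightarrow> 'a operation set \<Rightarrow> (nat \<Rightarrow> 'a) \<Rightarrow> (nat \<Rightarrow> 'a) \<Rightarrow> bool" where
  "is_reduction A F b a \<longleftrightarrow>
     (\<exists>as f.
        (\<forall>k. f k \<in> orderly_terms A F \<and> as k \<in> nlists (fst (f k)) A \<and> b k = snd (f k) (as k)) \<and>
        (\<exists>r. strict_mono r \<and> concat_seq as = a \<circ> r))"

text \<open>
  A finite subsequence of \<open>b\<close> is given by the strictly increasing list \<open>is\<close> of its indices.
\<close>

definition FR :: "'a set \<Rightarrow> 'a operation set \<Rightarrow> (nat \<Rightarrow> 'a) \<Rightarrow> 'a set" where
  "FR A F b = {snd f (map b is) | f is.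
     f \<in> orderly_terms A F \<and> sorted_wrt (<) is \<and> length is = fst f}"

definition ramsey_algebra :: "'a set \<Rightarrow> 'a operation set \<Rightarrow> bool" where
  "ramsey_algebra A F \<longleftrightarrow> finitary_algebra A F \<and>
     (\<forall>a X. range a \<subseteq> A \<longrightarrow> X \<subseteq> A \<longrightarrow>
        (\<exists>b. is_reduction A F b a \<and> (FR A F b \<subseteq> X \<or> FR A F b \<inter> X = {})))"

definition ring_operations :: "'a::ring operation set" where
  "ring_operations = {binary_operation UNIV (+), binary_operation UNIV (*)}"

lemma finitary_algebra_ring: "finitary_algebra UNIV (ring_operations :: 'a::ring operation set)"
  by (auto simp: finitary_algebra_def ring_operations_def operations_def binary_operation_def)

lemma identity_operation_in: "identity_operation A \<in> operations A"
  by (auto simp: operations_def identity_operation_def in_nlists_Suc_iff)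

lemma orderly_terms_subset:
  assumes "F \<subseteq> operations A"
  shows "orderly_terms A F \<subseteq> operations A"
proof
  fix f assume "f \<in> orderly_terms A F"
  then show "f \<in> operations A"
  proof induction
    case (basic f)
    then show ?case using assms by blast
  next
    case identity
    show ?case by (rule identity_operation_in)
  qed
qed

end

theory Submission
  imports Defs
begin

text \<open>
  An orderly term is affine in its last variable: substituting elements of a sequence \<open>a\<close> gives
  $c + d \cdot a_h$ with $h$ the largest index, where $c$ is $0$ or again a value of an orderly term
  in earlier members of \<open>a\<close>, and so is $d$, unless the coefficient is a formal unit. In an infinite
  ring without zero divisors every $a_h$ can be chosen outside a finite set so that $h$, $c$ and $d$
  are determined by the value. Iterating, the value determines two indices: the largest index $\nu$
  of the first monomial (pass to $c$ until $c = 0$) and the least index $\mu$ of the last monomial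
  (pass to $d$ until it is the formal unit). They satisfy $\nu(u+v) = \nu(u)$, $\mu(u+v) = \mu(v)$,
  $\nu(uv) = \nu(v)$ and $\mu(uv) = \mu(u)$. As all indices of $b_0$ precede those of $b_1$ whenever
  $b$ is a reduction of $a$, we have $\nu < \mu$ at $b_0 + b_1$ and $\mu < \nu$ at $b_0 b_1$, so
  colouring by $\nu < \mu$ admits no homogeneous reduction.
\<close>

section \<open>Values of orderly terms\<close>

text \<open>
  \<open>ordered_value a y l m \<nu> \<mu>\<close>: \<open>y\<close> is the value of an orderly ring term at members of \<open>a\<close> with
  increasing indices in \<open>{l..<m}\<close>; \<open>\<nu>\<close> and \<open>\<mu>\<close> are the indices described above, computed from the
  term.
\<close>

inductive ordered_value ::
    "(nat \<Rightarrow> 'a::ring) \<Rightarrow> 'a \<Rightarrow> nat \<Rightarrow> nat \<Rightarrow> nat \<Rightarrow> nat \<Rightarrow> bool" for a where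
  member: "\<lbrakk>l \<le> h; h < m\<rbrakk> \<Longrightarrow> ordered_value a (a h) l m h h"
| add: "\<lbrakk>ordered_value a u l m \<nu> \<mu>; ordered_value a v m k \<nu>' \<mu>'\<rbrakk>
    \<Longrightarrow> ordered_value a (u + v) l k \<nu> \<mu>'"
| mult: "\<lbrakk>ordered_value a u l m \<nu> \<mu>; ordered_value a v m k \<nu>' \<mu>'\<rbrakk>
    \<Longrightarrow> ordered_value a (u * v) l k \<nu>' \<mu>"

lemma ordered_value_bounds:
  "ordered_value a y l m \<nu> \<mu> \<Longrightarrow> l \<le> \<nu> \<and> \<nu> < m \<and> l \<le> \<mu> \<and> \<mu> < m"
  by (induction rule: ordered_value.induct) auto

lemma ordered_value_mono:
  assumes "ordered_value a y l m \<nu> \<mu>" "l' \<le> l" "m \<le> m'"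
  shows "ordered_value a y l' m' \<nu> \<mu>"
  using assms
proof (induction arbitrary: l' m' rule: ordered_value.induct)
  case (member l h m)
  then show ?case by (intro ordered_value.member) auto
next
  case (add u l m \<nu> \<mu> v k \<nu>' \<mu>')
  then show ?case by (meson ordered_value.add order_refl)
next
  case (mult u l m \<nu> \<mu> v k \<nu>' \<mu>')
  then show ?case by (meson ordered_value.mult order_refl)
qed

text \<open>Induction on the term, expanding its last factor or summand
  \<open>v = c + D (a h)\<close>: in \<open>u + v\<close> the element \<open>u\<close> is absorbed
  into \<open>c\<close>, and in \<open>u * v\<close> it distributes over both parts.
  \<open>D\<close> is a map so that \<open>id\<close> can serve as the formal unit.\<close>

lemma ordered_value_decomposition:
  assumes "ordered_value a y l m \<nu> \<mu>"
  obtains h c D where "l \<le> h" "h < m" "y = c + D (a h)"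
    "c = 0 \<and> \<nu> = h \<or> (\<exists>\<mu>'. ordered_value a c l h \<nu> \<mu>')"
    "D = id \<and> \<mu> = h \<or> (\<exists>d \<nu>'. D = (*) d \<and> ordered_value a d l h \<nu>' \<mu>)"
proof -
  have "\<exists>h c D. l \<le> h \<and> h < m \<and> y = c + D (a h) \<and>
      (c = 0 \<and> \<nu> = h \<or> (\<exists>\<mu>'. ordered_value a c l h \<nu> \<mu>')) \<and>
      (D = id \<and> \<mu> = h \<or> (\<exists>d \<nu>'. D = (*) d \<and> ordered_value a d l h \<nu>' \<mu>))"
    using assms
  proof induction
    case (member l h m)
    then show ?case by (intro exI[of _ h] exI[of _ 0] exI[of _ id]) auto
  next
    case (add u l m \<nu> \<mu> v k \<nu>' \<mu>')
    then obtain h c D where h: "m \<le> h" "h < k" "v = c + D (a h)"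
      and c: "c = 0 \<and> \<nu>' = h \<or> (\<exists>\<mu>'. ordered_value a c m h \<nu>' \<mu>')"
      and D: "D = id \<and> \<mu>' = h \<or> (\<exists>d \<nu>'. D = (*) d \<and> ordered_value a d m h \<nu>' \<mu>')"
      by blast
    have lm: "l \<le> m" using ordered_value_bounds[OF add.hyps(1)] by simp
    have "\<exists>\<mu>'. ordered_value a (u + c) l h \<nu> \<mu>'"
      using c
    proof (elim disjE exE conjE)
      assume "c = 0"
      then show ?thesis using ordered_value_mono[OF add.hyps(1) order_refl h(1)] by auto
    next
      fix \<rho> assume "ordered_value a c m h \<nu>' \<rho>"
      then show ?thesis using ordered_value.add[OF add.hyps(1)] by blast
    qed
    moreover have "D = id \<and> \<mu>' = h \<or> (\<exists>d \<nu>'. D = (*) d \<and> ordered_value a d l h \<nu>' \<mu>')"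
      using D lm by (blast intro: ordered_value_mono)
    moreover have "u + v = (u + c) + D (a h)" using h(3) by (simp add: add.assoc)
    ultimately show ?case
      using h order_trans[OF lm h(1)]
      by (intro exI[of _ h] exI[of _ "u + c"] exI[of _ D]) blast
  next
    case (mult u l m \<nu> \<mu> v k \<nu>' \<mu>')
    then obtain h c D where h: "m \<le> h" "h < k" "v = c + D (a h)"
      and c: "c = 0 \<and> \<nu>' = h \<or> (\<exists>\<mu>'. ordered_value a c m h \<nu>' \<mu>')"
      and D: "D = id \<and> \<mu>' = h \<or> (\<exists>d \<nu>'. D = (*) d \<and> ordered_value a d m h \<nu>' \<mu>')"
      by blast
    have lm: "l \<le> m" using ordered_value_bounds[OF mult.hyps(1)] by simp
    have c': "u * c = 0 \<and> \<nu>' = h \<or> (\<exists>\<mu>'. ordered_value a (u * c) l h \<nu>' \<mu>')"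
      using c mult.hyps(1) by (auto intro: ordered_value.mult)
    \<comment> \<open>Multiplication by \<open>u\<close> turns the formal unit into the coefficient
      \<open>u\<close>, and \<open>d\<close> into \<open>u * d\<close>; either way \<mu> is
      inherited from \<open>u\<close>.\<close>
    have "\<exists>d. (\<forall>x. u * D x = d * x) \<and> (\<exists>\<nu>'. ordered_value a d l h \<nu>' \<mu>)"
      using D
    proof (elim disjE exE conjE)
      assume "D = id"
      then show ?thesis
        using mult.hyps(1) h(1) by (intro exI[of _ u]) (auto intro: ordered_value_mono)
    next
      fix d \<rho> assume "D = (*) d" "ordered_value a d m h \<rho> \<mu>'"
      then show ?thesis
        using mult.hyps(1)
        by (intro exI[of _ "u * d"]) (auto simp: mult.assoc intro: ordered_value.mult)
    qed
    then obtain d where d: "\<forall>x. u * D x = d * x" "\<exists>\<nu>'. ordered_value a d l h \<nu>' \<mu>" by blast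
    have "u * v = u * c + d * a h" using h(3) d(1) by (simp add: distrib_left)
    then show ?case
      using h order_trans[OF lm h(1)] c' d(2)
      by (intro exI[of _ h] exI[of _ "u * c"] exI[of _ "(*) d"]) blast
  qed
  then show ?thesis using that by blast
qed

section \<open>Arguments from successive index intervals\<close>

fun consecutive_values :: "(nat \<Rightarrow> 'a::ring) \<Rightarrow> 'a list \<Rightarrow> nat \<Rightarrow> nat \<Rightarrow> bool" where
  "consecutive_values a [] l k \<longleftrightarrow> l \<le> k"
| "consecutive_values a (y # ys) l k \<longleftrightarrow>
     (\<exists>m \<nu> \<mu>. ordered_value a y l m \<nu> \<mu> \<and> consecutive_values a ys m k)"

lemma consecutive_values_mono:
  "consecutive_values a ys l k \<Longrightarrow> l' \<le> l \<Longrightarrow> consecutive_values a ys l' k"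
  by (cases ys) (auto intro: ordered_value_mono)

lemma consecutive_values_append:
  "consecutive_values a (xs @ ys) l k \<longleftrightarrow>
     (\<exists>m. consecutive_values a xs l m \<and> consecutive_values a ys m k)"
proof (induction xs arbitrary: l)
  case Nil
  show ?case by (auto intro: consecutive_values_mono)
next
  case (Cons x xs)
  show ?case by (simp add: Cons.IH) blast
qed

lemma consecutive_values_subsequence:
  assumes "strict_mono r" "i \<le> j"
  shows "consecutive_values a (map (a \<circ> r) [i..<j]) (r i) (r j)"
  using assms(2)
proof (induction rule: inc_induct)
  case base
  show ?case by simp
next
  case (step n)
  have "r n < r (Suc n)" using assms(1) by (simp add: strict_mono_def)
  then have "ordered_value a (a (r n)) (r n) (r (Suc n)) (r n) (r n)"
    by (intro ordered_value.member) auto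
  then show ?case using step by (auto simp: upt_conv_Cons)
qed

lemma split_into_blocks:
  assumes "length ys = sum_list (map n hs)"
  obtains xss where "ys = concat xss" "list_all2 (\<lambda>h xs. length xs = n h) hs xss"
proof -
  have "\<exists>xss. ys = concat xss \<and> list_all2 (\<lambda>h xs. length xs = n h) hs xss"
    using assms
  proof (induction hs arbitrary: ys)
    case Nil
    then show ?case by simp
  next
    case (Cons h hs)
    then have "length (drop (n h) ys) = sum_list (map n hs)" by simp
    then obtain xss where xss: "drop (n h) ys = concat xss"
      "list_all2 (\<lambda>h xs. length xs = n h) hs xss"
      using Cons.IH by blast
    have "ys = concat (take (n h) ys # xss)"
      using xss(1) by (metis append_take_drop_id concat.simps(2))
    moreover have "list_all2 (\<lambda>h xs. length xs = n h) (h # hs) (take (n h) ys # xss)"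
      using xss(2) Cons.prems by simp
    ultimately show ?case by blast
  qed
  then show ?thesis using that by blast
qed

text \<open>The inner half of an orderly composition: each block of arguments collapses to one value
  over the same index interval, so the intervals stay consecutive.\<close>

lemma consecutive_values_map2:
  assumes "list_all2 (\<lambda>h xs. length xs = fst h) hs xss"
    and "\<And>h ys l k. \<lbrakk>h \<in> set hs; length ys = fst h; consecutive_values a ys l k\<rbrakk>
      \<Longrightarrow> \<exists>\<nu> \<mu>. ordered_value a (snd h ys) l k \<nu> \<mu>"
    and "consecutive_values a (concat xss) l k"
  shows "consecutive_values a (map2 (\<lambda>h xs. snd h xs) hs xss) l k"
  using assms
proof (induction hs xss arbitrary: l rule: list_all2_induct)
  case Nil
  show ?case using Nil.prems(2) by simp
next
  case (Cons h hs xs xss)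
  obtain m where
    m: "consecutive_values a xs l m" "consecutive_values a (concat xss) m k"
    using Cons.prems(2) unfolding concat.simps consecutive_values_append by blast
  obtain \<nu> \<mu> where 1: "ordered_value a (snd h xs) l m \<nu> \<mu>"
    using Cons.prems(1)[OF _ Cons.hyps(1) m(1)] by force
  have 2: "consecutive_values a (map2 (\<lambda>h xs. snd h xs) hs xss) m k"
  proof (rule Cons.IH)
    show "\<exists>\<nu> \<mu>. ordered_value a (snd h ys) l k \<nu> \<mu>"
      if "h \<in> set hs" "length ys = fst h" "consecutive_values a ys l k" for h ys l k
      by (rule Cons.prems(1)) (use that in auto)
  qed (rule m(2))
  show ?case
    using 1 2 by (simp only: zip_Cons_Cons list.map prod.case consecutive_values.simps) blast
qed

lemma binary_operation_apply: "snd (binary_operation UNIV g) [u, v] = g u v"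
  by (simp add: binary_operation_def numeral_2_eq_2)

text \<open>The arguments are values rather than members of \<open>a\<close>, because in a composite
  the outer term is applied to values of the inner ones.\<close>

lemma orderly_term_ordered_value:
  assumes "f \<in> orderly_terms UNIV ring_operations"
    and "length ys = fst f" "consecutive_values a ys l k"
  shows "\<exists>\<nu> \<mu>. ordered_value a (snd f ys) l k \<nu> \<mu>"
  using assms
proof (induction arbitrary: ys l k)
  case (basic f)
  then have "length ys = 2" by (auto simp: ring_operations_def binary_operation_def)
  then obtain u v where ys: "ys = [u, v]" by (auto simp: length_Suc_conv numeral_2_eq_2)
  with basic.prems(2) obtain m n \<nu> \<mu> \<nu>' \<mu>' where
    u: "ordered_value a u l m \<nu> \<mu>" and v: "ordered_value a v m n \<nu>' \<mu>'" and "n \<le> k"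
    by auto
  then have v: "ordered_value a v m k \<nu>' \<mu>'" by (blast intro: ordered_value_mono)
  have "f = binary_operation UNIV (+) \<or> f = binary_operation UNIV (*)"
    using basic.hyps by (simp add: ring_operations_def)
  then have "snd f ys = u + v \<or> snd f ys = u * v"
    using binary_operation_apply[of _ u v] unfolding ys by blast
  then show ?case
    using ordered_value.add[OF u v] ordered_value.mult[OF u v] by metis
next
  case identity
  then obtain y where ys: "ys = [y]"
    by (auto simp: identity_operation_def length_Suc_conv)
  with identity.prems(2) obtain m \<nu> \<mu> where "ordered_value a y l m \<nu> \<mu>" "m \<le> k"
    by auto
  then have "ordered_value a y l k \<nu> \<mu>" by (blast intro: ordered_value_mono)
  moreover have "snd (identity_operation UNIV) [y] = y"
    by (simp add: identity_operation_def)
  ultimately show ?case unfolding ys by metis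
next
  case (composite g hs f)
  have comp: "length hs = fst g" "fst f = sum_list (map fst hs)"
    "\<And>xss. list_all2 (\<lambda>h xs. xs \<in> nlists (fst h) UNIV) hs xss \<Longrightarrow>
      snd f (concat xss) = snd g (map2 (\<lambda>h xs. snd h xs) hs xss)"
    using composite.hyps(3) unfolding is_orderly_composite_def by blast+
  obtain xss where xss: "ys = concat xss" "list_all2 (\<lambda>h xs. length xs = fst h) hs xss"
    by (rule split_into_blocks[OF trans[OF composite.prems(1) comp(2)]])
  have eq: "snd f ys = snd g (map2 (\<lambda>h xs. snd h xs) hs xss)"
    unfolding xss(1)
    by (rule comp(3)[OF list_all2_mono[OF xss(2)]]) (simp only: in_nlists_UNIV)
  have "consecutive_values a (map2 (\<lambda>h xs. snd h xs) hs xss) l k"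
    using xss(2)
  proof (rule consecutive_values_map2)
    show "\<exists>\<nu> \<mu>. ordered_value a (snd h ys) l k \<nu> \<mu>"
      if "h \<in> set hs" "length ys = fst h" "consecutive_values a ys l k" for h ys l k
      using bspec[OF composite.IH(2) that(1)] that(2,3) by blast
    show "consecutive_values a (concat xss) l k" using composite.prems(2) xss(1) by simp
  qed
  moreover have "length (map2 (\<lambda>h xs. snd h xs) hs xss) = fst g"
    using list_all2_lengthD[OF xss(2)] comp(1) by simp
  ultimately show ?case unfolding eq by (intro composite.IH(1))
qed

lemma reduction_ordered_values:
  fixes a :: "nat \<Rightarrow> 'a::ring"
  assumes "is_reduction UNIV ring_operations b a"
  obtains l m k \<nu> \<mu> \<nu>' \<mu>' where
    "ordered_value a (b 0) l m \<nu> \<mu>" "ordered_value a (b 1) m k \<nu>' \<mu>'"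
proof -
  obtain as f r where
    f_as: "\<forall>k. f k \<in> orderly_terms UNIV ring_operations \<and> as k \<in> nlists (fst (f k)) UNIV \<and>
      b k = snd (f k) (as k)" and r: "strict_mono r" and eq: "concat_seq as = a \<circ> r"
    using assms unfolding is_reduction_def by blast
  have f: "f k \<in> orderly_terms UNIV ring_operations" and b: "b k = snd (f k) (as k)" for k
    using f_as by blast+
  have as: "length (as k) = fst (f k)" for k using f_as by (blast intro: nlistsE_length)
  have "(ring_operations :: 'a operation set) \<subseteq> operations UNIV"
    using finitary_algebra_ring by (auto simp: finitary_algebra_def)
  then have "f k \<in> operations UNIV" for k using f orderly_terms_subset by blast
  \<comment> \<open>Positive arities make every block nonempty, on which the meaning of
    \<open>concat_seq\<close> depends.\<close>
  then have "fst (f k) \<ge> 1" for k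
    unfolding operations_def mem_Collect_eq case_prod_unfold by blast
  then have pos: "length (as k) > 0" for k by (simp add: as Suc_le_eq)
  define xs where "xs = as 0 @ as 1"
  \<comment> \<open>\<open>concat_seq as i\<close> sees only the first \<open>Suc i\<close> blocks.
    At \<open>i = 0\<close> the block \<open>as 1\<close> is missing, but \<open>as 0\<close> is
    nonempty; for larger \<open>i\<close> all of \<open>xs\<close> is a prefix.\<close>
  have "xs ! i = (a \<circ> r) i" if i: "i < length xs" for i
  proof (cases i)
    case 0
    then show ?thesis
      using pos[of 0] by (simp flip: eq add: concat_seq_def xs_def nth_append)
  next
    case (Suc j)
    have "[0..<Suc i] = [0, 1] @ [2..<Suc i]"
      using Suc by (simp add: upt_conv_Cons numeral_2_eq_2 del: upt_Suc)
    then have "concat (map as [0..<Suc i]) = xs @ concat (map as [2..<Suc i])"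
      by (simp add: xs_def del: upt_Suc)
    then have "concat_seq as i = xs ! i"
      using i unfolding concat_seq_def by (simp add: nth_append del: upt_Suc)
    then show ?thesis by (simp add: eq)
  qed
  then have "xs = map (a \<circ> r) [0..<length xs]" by (intro nth_equalityI) auto
  then have "consecutive_values a xs (r 0) (r (length xs))"
    using consecutive_values_subsequence[OF r, of 0 "length xs" a] by simp
  then obtain m where "consecutive_values a (as 0) (r 0) m"
    "consecutive_values a (as 1) m (r (length xs))"
    unfolding xs_def consecutive_values_append by blast
  then show ?thesis
    using orderly_term_ordered_value[OF f as] that unfolding b by meson
qed

section \<open>Generic sequences\<close>

definition multipliers :: "'a::ring set \<Rightarrow> ('a \<Rightarrow> 'a) set" where
  "multipliers E = insert id ((*) ` E)"

definition affine_value :: "'a::ring \<Rightarrow> 'a \<times> ('a \<Rightarrow> 'a) \<Rightarrow> 'a" where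
  "affine_value x p = fst p + snd p x"

lemma multipliers_diff: "D \<in> multipliers E \<Longrightarrow> D (x - y) = D x - D y"
  by (auto simp: multipliers_def right_diff_distrib)

text \<open>Cancelling \<open>x\<close> on the right in \<open>x * t * x = x * x\<close> gives
  \<open>x * t = x\<close>; then \<open>x * t * z = x * z\<close>, and \<open>x\<close> cancels on
  the left.\<close>

lemma left_identity_if_fixes_nonzero:
  fixes t x :: "'a::ring_no_zero_divisors"
  assumes "t * x = x" "x \<noteq> 0"
  shows "t * z = z"
proof -
  have "(x * t - x) * x = 0" using assms(1) by (simp add: left_diff_distrib mult.assoc)
  then have "x * t = x" using assms(2) by simp
  then have "x * (t * z - z) = 0" by (simp add: right_diff_distrib flip: mult.assoc)
  then show ?thesis using assms(2) by simp
qed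

lemma multipliers_eq_if_agree:
  fixes E :: "'a::ring_no_zero_divisors set"
  assumes "D \<in> multipliers E" "D' \<in> multipliers E" "D x = D' x" "x \<noteq> 0"
  shows "D = D'"
  using assms left_identity_if_fixes_nonzero[of _ x]
  by (auto simp: multipliers_def fun_eq_iff)

text \<open>Cancelling a nonzero \<open>z\<close> in \<open>e * z = z = e' * z\<close> leaves at
  most one left identity. This lets \<open>E 0\<close> be finite.\<close>

lemma finite_left_identities:
  "finite {e :: 'a::ring_no_zero_divisors. \<forall>x. e * x = x}"
proof (cases "\<exists>z::'a. z \<noteq> 0")
  case True
  then obtain z :: 'a where "z \<noteq> 0" by blast
  have "e = e'" if "\<forall>x. e * x = x" "\<forall>x. e' * x = x" for e e' :: 'a
    using that \<open>z \<noteq> 0\<close> by (metis mult_right_cancel)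
  then have "\<exists>e. {e :: 'a. \<forall>x. e * x = x} \<subseteq> {e}" by blast
  then show ?thesis by (meson finite.emptyI finite.insertI finite_subset)
next
  case False
  then have "(UNIV :: 'a set) \<subseteq> {0}" by auto
  then show ?thesis by (meson finite.emptyI finite.insertI finite_subset subset_UNIV)
qed

text \<open>Distinct pairs agree at no more than one point: by additivity, agreement at
  \<open>x\<close> and \<open>y\<close> gives \<open>D (x - y) = D' (x - y)\<close>, hence
  \<open>D = D'\<close> and equal constants. Finitely many pairs thus exclude only finitely many
  \<open>x\<close>, collected in \<open>B\<close>.\<close>

lemma exists_generic_element:
  fixes E :: "'a::ring_no_zero_divisors set"
  assumes "infinite (UNIV :: 'a set)" "finite E"
  shows "\<exists>x. inj_on (affine_value x) (E \<times> multipliers E)"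
proof -
  define P where "P = E \<times> multipliers E"
  define B where
    "B = (\<Union>p\<in>P. \<Union>q\<in>P. if p = q then {} else {x. affine_value x p = affine_value x q})"
  have "finite {x. affine_value x p = affine_value x q}" if "p \<in> P" "q \<in> P" "p \<noteq> q" for p q
  proof -
    obtain c D c' D' where pq: "p = (c, D)" "q = (c', D')" by (cases p, cases q)
    with that have D: "D \<in> multipliers E" "D' \<in> multipliers E" by (auto simp: P_def)
    have "x = y" if xy: "c + D x = c' + D' x" "c + D y = c' + D' y" for x y
    proof (rule ccontr)
      assume "x \<noteq> y"
      have "D x - D y = D' x - D' y" using xy by (metis add_diff_cancel_left)
      then have "D (x - y) = D' (x - y)" using D by (simp add: multipliers_diff)
      then have "D = D'" using D \<open>x \<noteq> y\<close> by (intro multipliers_eq_if_agree) auto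
      then show False using xy \<open>p \<noteq> q\<close> pq by simp
    qed
    then have "\<exists>z. {x. affine_value x p = affine_value x q} \<subseteq> {z}"
      unfolding affine_value_def pq fst_conv snd_conv by blast
    then show ?thesis by (meson finite.emptyI finite.insertI finite_subset)
  qed
  moreover have "finite P" using assms(2) by (simp add: P_def multipliers_def)
  ultimately have "finite B" unfolding B_def by (auto split: if_splits)
  then obtain x where "x \<notin> B" using assms(1) ex_new_if_finite by blast
  then have "inj_on (affine_value x) P" by (force simp: B_def inj_on_def split: if_splits)
  then show ?thesis unfolding P_def by blast
qed

text \<open>
  \<open>E n\<close> contains all values at indices below \<open>n\<close>. Left identities are put into \<open>E 0\<close>, so that no
  value is one: multiplication by it would be indistinguishable from the formal unit \<open>id\<close>.
\<close>

locale generic_sequence =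
  fixes a :: "nat \<Rightarrow> 'a::ring_no_zero_divisors" and E :: "nat \<Rightarrow> 'a set"
  assumes nontrivial: "\<exists>z::'a. z \<noteq> 0"
    and zero_in: "0 \<in> E 0"
    and left_identity_in: "(\<And>x. e * x = x) \<Longrightarrow> e \<in> E 0"
    and generic: "inj_on (affine_value (a n)) (E n \<times> multipliers (E n))"
    and E_Suc: "E (Suc n) = affine_value (a n) ` (E n \<times> multipliers (E n))"
begin

lemma affine_in_E_Suc:
  assumes "c \<in> E n" "D \<in> multipliers (E n)"
  shows "c + D (a n) \<in> E (Suc n)"
  using imageI[of "(c, D)" "E n \<times> multipliers (E n)" "affine_value (a n)"] assms
  by (simp add: E_Suc affine_value_def)

lemma zero_in_all: "0 \<in> E n"
proof (induction n)
  case 0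
  show ?case by (rule zero_in)
next
  case (Suc n)
  then show ?case using affine_in_E_Suc[of 0 n "(*) 0"] by (simp add: multipliers_def)
qed

lemma E_mono: "m \<le> n \<Longrightarrow> E m \<subseteq> E n"
proof (rule lift_Suc_mono_le)
  fix n
  show "E n \<subseteq> E (Suc n)"
  proof
    fix c assume "c \<in> E n"
    then show "c \<in> E (Suc n)"
      using affine_in_E_Suc[of c n "(*) 0"] zero_in_all by (simp add: multipliers_def)
  qed
qed

lemma generic_cancel:
  assumes "c \<in> E n" "c' \<in> E n" "D \<in> multipliers (E n)" "D' \<in> multipliers (E n)"
    and "c + D (a n) = c' + D' (a n)"
  shows "c = c' \<and> D = D'"
  using inj_onD[OF generic, of n "(c, D)" "(c', D')"] assms by (simp add: affine_value_def)

section \<open>Recovering the indices from the value\<close>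

lemma ordered_value_in: "ordered_value a y l m \<nu> \<mu> \<Longrightarrow> y \<in> E m"
proof (induction m arbitrary: y l \<nu> \<mu> rule: less_induct)
  case (less m)
  from less.prems obtain h c D where h: "h < m" "y = c + D (a h)"
    and c: "c = 0 \<and> \<nu> = h \<or> (\<exists>\<mu>'. ordered_value a c l h \<nu> \<mu>')"
    and D: "D = id \<and> \<mu> = h \<or> (\<exists>d \<nu>'. D = (*) d \<and> ordered_value a d l h \<nu>' \<mu>)"
    by (rule ordered_value_decomposition)
  have "c \<in> E h" using c less.IH[OF h(1)] zero_in_all by blast
  moreover have "D \<in> multipliers (E h)"
    using D less.IH[OF h(1)] by (auto simp: multipliers_def)
  ultimately have "y \<in> E (Suc h)" using affine_in_E_Suc h(2) by simp
  then show ?case using h(1) E_mono[of "Suc h" m] by auto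
qed

lemma ordered_value_decomposition_in:
  assumes "ordered_value a y l m \<nu> \<mu>"
  obtains h c D where "h < m" "y = c + D (a h)" "c \<in> E h" "D \<in> multipliers (E h)"
    "c = 0 \<and> \<nu> = h \<or> (\<exists>\<mu>'. ordered_value a c l h \<nu> \<mu>')"
    "D = id \<and> \<mu> = h \<or> (\<exists>d \<nu>'. D = (*) d \<and> ordered_value a d l h \<nu>' \<mu>)"
proof -
  from assms obtain h c D where h: "h < m" "y = c + D (a h)"
    and c: "c = 0 \<and> \<nu> = h \<or> (\<exists>\<mu>'. ordered_value a c l h \<nu> \<mu>')"
    and D: "D = id \<and> \<mu> = h \<or> (\<exists>d \<nu>'. D = (*) d \<and> ordered_value a d l h \<nu>' \<mu>)"
    by (rule ordered_value_decomposition)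
  moreover have "c \<in> E h" using c ordered_value_in zero_in_all by blast
  moreover have "D \<in> multipliers (E h)" using D ordered_value_in by (auto simp: multipliers_def)
  ultimately show ?thesis using that by blast
qed

text \<open>An element of \<open>E h\<close> has the affine representation with multiplier \<open>0\<close>.\<close>

lemma affine_notin:
  assumes "c \<in> E h" "D \<in> multipliers (E h)" "D \<noteq> (*) 0"
  shows "c + D (a h) \<notin> E h"
proof
  assume "c + D (a h) \<in> E h"
  moreover have "(*) 0 \<in> multipliers (E h)" using zero_in_all by (simp add: multipliers_def)
  ultimately show False
    using generic_cancel[of c h "c + D (a h)" D "(*) 0"] assms by simp
qed

lemma mult_eq_iff: "(*) t = (*) (t' :: 'a) \<longleftrightarrow> t = t'"
  using nontrivial by (metis mult_right_cancel)

lemma id_neq_zero: "id \<noteq> (*) (0 :: 'a)"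
  using nontrivial by (metis id_apply mult_zero_left)

text \<open>By induction the coefficient of \<open>a h\<close> is not zero, so the value lies
  outside \<open>E h\<close>, which includes \<open>E 0\<close>.\<close>

lemma ordered_value_notin_base: "ordered_value a y l m \<nu> \<mu> \<Longrightarrow> y \<notin> E 0"
proof (induction m arbitrary: y l \<nu> \<mu> rule: less_induct)
  case (less m)
  from less.prems obtain h c D where h: "h < m" "y = c + D (a h)"
    and "c \<in> E h" "D \<in> multipliers (E h)"
    and D: "D = id \<and> \<mu> = h \<or> (\<exists>d \<nu>'. D = (*) d \<and> ordered_value a d l h \<nu>' \<mu>)"
    by (rule ordered_value_decomposition_in)
  moreover have "D \<noteq> (*) 0"
    using D less.IH[OF h(1)] zero_in id_neq_zero by (auto simp: mult_eq_iff)
  ultimately have "y \<notin> E h" using affine_notin by simp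
  then show ?case using E_mono[of 0 h] by blast
qed

lemma ordered_value_nonzero: "ordered_value a y l m \<nu> \<mu> \<Longrightarrow> y \<noteq> 0"
  using ordered_value_notin_base zero_in by blast

lemma ordered_value_not_identity: "ordered_value a y l m \<nu> \<mu> \<Longrightarrow> (*) y \<noteq> id"
  using ordered_value_notin_base left_identity_in by (metis id_apply)

lemma ordered_value_indices_unique:
  assumes "ordered_value a y l m \<nu> \<mu>" "ordered_value a y l' m' \<nu>' \<mu>'"
  shows "\<nu> = \<nu>' \<and> \<mu> = \<mu>'"
  using assms
proof (induction m arbitrary: y l \<nu> \<mu> l' m' \<nu>' \<mu>' rule: less_induct)
  case (less m)
  obtain h c D where h: "h < m" "y = c + D (a h)" "c \<in> E h" "D \<in> multipliers (E h)"
    and c: "c = 0 \<and> \<nu> = h \<or> (\<exists>\<mu>'. ordered_value a c l h \<nu> \<mu>')"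
    and D: "D = id \<and> \<mu> = h \<or> (\<exists>d \<nu>'. D = (*) d \<and> ordered_value a d l h \<nu>' \<mu>)"
    using less.prems(1) by (rule ordered_value_decomposition_in)
  obtain h' c' D' where
    h': "h' < m'" "y = c' + D' (a h')" "c' \<in> E h'" "D' \<in> multipliers (E h')"
    and c': "c' = 0 \<and> \<nu>' = h' \<or> (\<exists>\<mu>. ordered_value a c' l' h' \<nu>' \<mu>)"
    and D': "D' = id \<and> \<mu>' = h' \<or> (\<exists>d \<nu>. D' = (*) d \<and> ordered_value a d l' h' \<nu> \<mu>')"
    using less.prems(2) by (rule ordered_value_decomposition_in)
  have "D \<noteq> (*) 0" "D' \<noteq> (*) 0"
    using D D' id_neq_zero ordered_value_nonzero by (auto simp: mult_eq_iff)
  \<comment> \<open>The index \<open>h\<close> is recovered as the stage at which \<open>y\<close>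
    first enters the increasing sets \<open>E\<close>.\<close>
  then have "y \<notin> E h" "y \<notin> E h'" using affine_notin h h' by metis+
  moreover have "y \<in> E (Suc h)" "y \<in> E (Suc h')"
    using affine_in_E_Suc h h' by metis+
  ultimately have hh: "h = h'"
    using E_mono[of "Suc h" h'] E_mono[of "Suc h'" h]
    by (meson Suc_leI linorder_neqE_nat subsetD)
  have eq: "c = c'" "D = D'" using generic_cancel[of c h c' D D'] h h' hh by auto
  \<comment> \<open>A value is never \<open>0\<close>, so both decompositions stop here or both
    continue with \<open>c\<close> below \<open>h\<close>. For \<mu> the same holds because
    multiplication by a value is never \<open>id\<close>.\<close>
  have "\<nu> = \<nu>'"
    using c c' less.IH[OF h(1)] ordered_value_nonzero hh unfolding eq by blast
  moreover have "\<mu> = \<mu>'"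
    using D D' less.IH[OF h(1)] ordered_value_not_identity hh unfolding eq
    by (metis mult_eq_iff)
  ultimately show ?case by blast
qed

end

section \<open>Construction of a generic sequence\<close>

context
begin

text \<open>Recursion on the sets alone suffices, since the member \<open>a n\<close> is a choice
  depending only on \<open>E n\<close>.\<close>

private primrec exceptional_set :: "nat \<Rightarrow> 'a::ring_no_zero_divisors set" where
  "exceptional_set 0 = insert 0 {e. \<forall>x. e * x = x}"
| "exceptional_set (Suc n) =
    (let E = exceptional_set n
     in affine_value (SOME x. inj_on (affine_value x) (E \<times> multipliers E)) ` (E \<times> multipliers E))"

lemma exists_generic_sequence:
  assumes "infinite (UNIV :: 'a::ring_no_zero_divisors set)"
  obtains a :: "nat \<Rightarrow> 'a::ring_no_zero_divisors" and E where "generic_sequence a E"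
proof
  let ?E = "exceptional_set :: nat \<Rightarrow> 'a set"
  let ?a = "\<lambda>n. SOME x. inj_on (affine_value x) (?E n \<times> multipliers (?E n))"
  have fin: "finite (?E n)" for n
  proof (induction n)
    case 0
    show ?case using finite_left_identities by simp
  next
    case (Suc n)
    then show ?case by (simp add: Let_def multipliers_def)
  qed
  show "generic_sequence ?a ?E"
  proof
    show "\<exists>z::'a. z \<noteq> 0" using ex_new_if_finite[OF assms, of "{0}"] by auto
    show "inj_on (affine_value (?a n)) (?E n \<times> multipliers (?E n))" for n
      using exists_generic_element[OF assms fin] by (rule someI_ex)
  qed (auto simp: Let_def)
qed

end

section \<open>Infinite rings without zero divisors\<close>

lemma binary_operation_FR:
  assumes "binary_operation UNIV f \<in> F"
  shows "f (b 0) (b 1) \<in> FR UNIV F b"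
  unfolding FR_def
  using orderly_terms.basic[OF assms]
  by (intro CollectI exI[of _ "binary_operation UNIV f"] exI[of _ "[0, 1]"])
     (auto simp: binary_operation_apply, simp add: binary_operation_def)

lemma infinite_ring_not_ramsey:
  assumes "infinite (UNIV :: 'a::ring_no_zero_divisors set)"
  shows "\<not> ramsey_algebra UNIV (ring_operations :: 'a operation set)"
proof
  assume ramsey: "ramsey_algebra UNIV (ring_operations :: 'a operation set)"
  obtain a :: "nat \<Rightarrow> 'a" and E where "generic_sequence a E"
    using exists_generic_sequence[OF assms] .
  then interpret generic_sequence a E .
  define X where "X = {y. \<exists>l m \<nu> \<mu>. ordered_value a y l m \<nu> \<mu> \<and> \<nu> < \<mu>}"
  obtain b where b: "is_reduction UNIV ring_operations b a"
    and hom: "FR UNIV ring_operations b \<subseteq> X \<or> FR UNIV ring_operations b \<inter> X = {}"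
    using ramsey unfolding ramsey_algebra_def by blast
  obtain l m k \<nu> \<mu> \<nu>' \<mu>' where
    b01: "ordered_value a (b 0) l m \<nu> \<mu>" "ordered_value a (b 1) m k \<nu>' \<mu>'"
    using reduction_ordered_values[OF b] .
  then have less: "\<nu> < \<mu>'" "\<mu> < \<nu>'" by (auto dest!: ordered_value_bounds)
  have "b 0 + b 1 \<in> X" using ordered_value.add[OF b01] less(1) by (auto simp: X_def)
  \<comment> \<open>Membership in \<open>X\<close> asks for only one suitable representation, so
    excluding the product requires uniqueness of the indices.\<close>
  moreover have "b 0 * b 1 \<notin> X"
    using ordered_value_indices_unique[OF ordered_value.mult[OF b01]] less(2)
    by (fastforce simp: X_def)
  moreover have "b 0 + b 1 \<in> FR UNIV ring_operations b" "b 0 * b 1 \<in> FR UNIV ring_operations b"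
    using binary_operation_FR[of "(+)" ring_operations b]
      binary_operation_FR[of "(*)" ring_operations b]
    by (simp_all add: ring_operations_def)
  ultimately show False using hom by blast
qed

theorem theorem5p5:
  shows "(infinite (UNIV :: 'a::ring_no_zero_divisors set) \<longrightarrow>
            \<not> ramsey_algebra UNIV (ring_operations :: 'a operation set)) \<and>
         (infinite (UNIV :: 'b::idom set) \<longrightarrow>
            \<not> ramsey_algebra UNIV (ring_operations :: 'b operation set))"
  \<comment> \<open>The second part is an instance, as \<open>idom\<close> is a subclass of
    \<open>ring_no_zero_divisors\<close>.\<close>
  by (intro conjI impI infinite_ring_not_ramsey)

end
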